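(* Consider the non-clairvoyant online weighted coflow scheduling problem described in the context, with $p$ the maximum number of flows (nonzero demand entries) of any coflow. The BlindFlow rate allocation \[ r_{ijk}(t) = \frac{w_k \mathbf{1}_{ijk}^t}{\sum_{l \in Q_t}\sum_{u} \frac{w_l}{c^{\mathrm{op}}_j}\mathbf{1}_{ujl}^t + \sum_{l \in Q_t}\sum_{v} \frac{w_l}{c^{\mathrm{ip}}_i}\mathbf{1}_{ivl}^t} \] (and $r_{ijk}(t)=0$ for $t<R_k$) is feasible, i.e., for every time $t$, every input port $i$ and every output port $j$, $\sum_{k\in Q_t}\sum_j r_{ijk}(t)\le c^{\mathrm{ip}}_i$ and $\sum_{k\in Q_t}\sum_i r_{ijk}(t)\le c^{\mathrm{op}}_j$. Moreover, if $J_{\mathrm{OPT}}$ is the optimal (clairvoyant, offline) weighted sum of coflow completion times, then the schedule produced by BlindFlow has weighted sum of coflow completion times $\sum_k w_k T_k^{\mathrm{alg}} \le 8p\, J_{\mathrm{OPT}}$.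
   Context: An $m\times m$ switch has input ports $i=1,\dots,m$ with capacities $c^{\mathrm{ip}}_i>0$ and output ports $j=1,\dots,m$ with capacities $c^{\mathrm{op}}_j>0$. Time is slotted, $t=0,1,2,\dots$. There are $n$ coflows; coflow $k$ consists of a demand matrix $C_k=[d_{ijk}]$ with nonnegative entries, a release time $R_k\ge 0$, and a weight $w_k>0$. Each nonzero entry $d_{ijk}$ is a flow: $d_{ijk}$ units of data must be sent from input port $i$ to output port $j$. A schedule assigns rates $x_{ijkt}\ge 0$ (rate of flow $(i,j)$ of coflow $k$ in slot $t$), zero for $t<R_k$, subject to $\sum_{j,k}x_{ijkt}\le c^{\mathrm{ip}}_i$ for all $i,t$ and $\sum_{i,k}x_{ijkt}\le c^{\mathrm{op}}_j$ for all $j,t$; flow $(i,j)$ of coflow $k$ is finished once $\sum_t x_{ijkt}\ge d_{ijk}$. The completion time $T_k$ of coflow $k$ is the time by which all its flows are finished (i.e., $\sum_t x_{ijkt}/d_{ijk}\ge 1$ and $x_{ijkt}=0$ for $t>T_k$, for all its flows). The objective is to minimize $\sum_k w_k T_k$; $J_{\mathrm{OPT}}$ denotes the minimum over all feasible schedules, with full knowledge of all demands and release times. In the non-clairvoyant online setting, at time $t$ the scheduler only knows, for released coflows $k\in Q_t=\{k: t\ge R_k\}$, their weights and the indicators $\mathbf{1}^t_{ijk}\in\{0,1\}$, where $\mathbf{1}^t_{ijk}=1$ iff flow $(i,j)$ of coflow $k$ exists (i.e., $d_{ijk}>0$) and is not yet finished at time $t$; the demand values $d_{ijk}$ are unknown.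 $p$ is the maximum over $k$ of the number of nonzero entries of $C_k$. $T_k^{\mathrm{alg}}$ is the completion time of coflow $k$ when the rates $r_{ijk}(t)$ are used.
   Formalization: Completion time T_k is measured at the end of the last used slot (no data in slots t ≥ T_k, rather than t > T_k); with t > T_k one unit-demand flow on unit ports has J_OPT = 0 while BlindFlow's cost is 1. *)

theory Defs
  imports Complex_Main
begin

text \<open>
  The ports of an \<open>m \<times> m\<close> switch are indexed by a finite type \<open>'p\<close> (used both for
  input and for output ports), the \<open>n\<close> coflows by a finite type \<open>'k\<close>.
  Slot \<open>t = 0, 1, 2, \<dots>\<close> is the time interval from \<open>t\<close> to \<open>t + 1\<close>; a rate is
  constant during a slot and therefore equals the amount of data sent in it.
\<close>

record ('p, 'k) coflow_instance =
  cap_in  :: "'p \<Rightarrow> real"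
  cap_out :: "'p \<Rightarrow> real"
  demand  :: "'p \<Rightarrow> 'p \<Rightarrow> 'k \<Rightarrow> real"
  release :: "'k \<Rightarrow> real"
  weight  :: "'k \<Rightarrow> real"

definition valid_instance :: "('p, 'k) coflow_instance \<Rightarrow> bool" where
  "valid_instance I \<longleftrightarrow>
     (\<forall>i. cap_in I i > 0) \<and> (\<forall>j. cap_out I j > 0) \<and>
     (\<forall>i j k. demand I i j k \<ge> 0) \<and> (\<forall>k. release I k \<ge> 0) \<and> (\<forall>k. weight I k > 0)"

definition max_flows :: "('p::finite, 'k::finite) coflow_instance \<Rightarrow> nat" where
  "max_flows I = Max (range (\<lambda>k. card {(i, j). demand I i j k \<noteq> 0}))"

definition released :: "('p, 'k) coflow_instance \<Rightarrow> nat \<Rightarrow> 'k set" where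
  "released I t = {k. real t \<ge> release I k}"

type_synonym ('p, 'k) rates = "'p \<Rightarrow> 'p \<Rightarrow> 'k \<Rightarrow> nat \<Rightarrow> real"

definition feasible_rates ::
    "('p::finite, 'k::finite) coflow_instance \<Rightarrow> ('p, 'k) rates \<Rightarrow> bool" where
  "feasible_rates I x \<longleftrightarrow>
     (\<forall>i j k t. x i j k t \<ge> 0) \<and>
     (\<forall>i j k t. real t < release I k \<longrightarrow> x i j k t = 0) \<and>
     (\<forall>i t. (\<Sum>j\<in>UNIV. \<Sum>k\<in>UNIV. x i j k t) \<le> cap_in I i) \<and>
     (\<forall>j t. (\<Sum>i\<in>UNIV. \<Sum>k\<in>UNIV. x i j k t) \<le> cap_out I j)"

text \<open>
  Only the slots \<open>0, \<dots>, T - 1\<close> have elapsed at time \<open>T\<close>, so a coflow is done by time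
  \<open>T\<close> if these slots meet its demands and the slots \<open>t \<ge> T\<close>, which lie after time \<open>T\<close>,
  carry none of its data.  In particular a flow served entirely in slot \<open>0\<close> completes
  at time \<open>1\<close>; counting it as completing at time \<open>0\<close> would allow an optimal cost of \<open>0\<close>
  and rule out any finite competitive ratio.  A coflow without flows is done at time \<open>0\<close>.
\<close>

definition done_by ::
    "('p, 'k) coflow_instance \<Rightarrow> ('p, 'k) rates \<Rightarrow> 'k \<Rightarrow> nat \<Rightarrow> bool" where
  "done_by I x k T \<longleftrightarrow>
     (\<forall>i j. demand I i j k > 0 \<longrightarrow>
        (\<Sum>t<T. x i j k t / demand I i j k) \<ge> 1 \<and> (\<forall>t\<ge>T. x i j k t = 0))"

definition feasible_schedule ::
    "('p::finite, 'k::finite) coflow_instance \<Rightarrow> ('p, 'k) rates \<Rightarrow> ('k \<Rightarrow> nat) \<Rightarrow> bool" where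
  "feasible_schedule I x T \<longleftrightarrow> feasible_rates I x \<and> (\<forall>k. done_by I x k (T k))"

text \<open>Meaningful only if \<open>k\<close> is done by some time under the rates \<open>x\<close>.\<close>

definition completion_time ::
    "('p, 'k) coflow_instance \<Rightarrow> ('p, 'k) rates \<Rightarrow> 'k \<Rightarrow> nat" where
  "completion_time I x k = (LEAST T. done_by I x k T)"

definition cost :: "('p, 'k::finite) coflow_instance \<Rightarrow> ('k \<Rightarrow> nat) \<Rightarrow> real" where
  "cost I T = (\<Sum>k\<in>UNIV. weight I k * real (T k))"

text \<open>
  The infimum is a minimum: completion times are natural numbers and weights are positive,
  so only finitely many cost values lie below any bound.
\<close>

definition J_opt :: "('p::finite, 'k::finite) coflow_instance \<Rightarrow> real" where
  "J_opt I = Inf {cost I T | x T. feasible_schedule I x T}"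

text \<open>The indicator of an existing flow \<open>(i, j)\<close> of \<open>k\<close> that has received less than its demand
  when \<open>a i j k\<close> is the amount sent so far.\<close>

definition unfinished ::
    "('p, 'k) coflow_instance \<Rightarrow> ('p \<Rightarrow> 'p \<Rightarrow> 'k \<Rightarrow> real) \<Rightarrow> 'p \<Rightarrow> 'p \<Rightarrow> 'k \<Rightarrow> real" where
  "unfinished I a i j k = (if demand I i j k > 0 \<and> a i j k < demand I i j k then 1 else 0)"

text \<open>
  The allocation rule, given the indicators \<open>e\<close> at time \<open>t\<close>; it does not read the demands.
  A vanishing denominator occurs only together with a vanishing numerator, and then the
  value is \<open>0\<close>.
\<close>

definition blindflow_alloc ::
    "('p::finite, 'k::finite) coflow_instance \<Rightarrow> nat \<Rightarrow> ('p \<Rightarrow> 'p \<Rightarrow> 'k \<Rightarrow> real)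
       \<Rightarrow> 'p \<Rightarrow> 'p \<Rightarrow> 'k \<Rightarrow> real" where
  "blindflow_alloc I t e i j k =
     (if real t < release I k then 0
      else weight I k * e i j k /
        ((\<Sum>l\<in>released I t. \<Sum>u\<in>UNIV. weight I l / cap_out I j * e u j l) +
         (\<Sum>l\<in>released I t. \<Sum>v\<in>UNIV. weight I l / cap_in I i * e i v l)))"

primrec blindflow_sent ::
    "('p::finite, 'k::finite) coflow_instance \<Rightarrow> nat \<Rightarrow> 'p \<Rightarrow> 'p \<Rightarrow> 'k \<Rightarrow> real" where
  "blindflow_sent I 0 = (\<lambda>i j k. 0)"
| "blindflow_sent I (Suc t) = (\<lambda>i j k. blindflow_sent I t i j k
      + blindflow_alloc I t (unfinished I (blindflow_sent I t)) i j k)"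

definition blindflow :: "('p::finite, 'k::finite) coflow_instance \<Rightarrow> ('p, 'k) rates" where
  "blindflow I i j k t = blindflow_alloc I t (unfinished I (blindflow_sent I t)) i j k"

lemma blindflow_sent_eq: "blindflow_sent I t i j k = (\<Sum>s<t. blindflow I i j k s)"
  by (induction t) (simp_all add: blindflow_def)

lemma blindflow_eq:
  "blindflow I i j k t =
     blindflow_alloc I t (unfinished I (\<lambda>i j k. \<Sum>s<t. blindflow I i j k s)) i j k"
  unfolding blindflow_sent_eq[symmetric] by (simp add: blindflow_def)

end

theory Submission
  imports Defs
begin

text \<open>
  Dual fitting. Treat every flow \<open>(i, j)\<close> of a coflow \<open>k\<close> as a job of weight \<open>w\<^sub>k\<close> with its own
  finishing time \<open>T\<^sub>f\<close> under BlindFlow; this costs the factor \<open>p\<close> when compared with an arbitrary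
  schedule. Let \<open>L\<^sub>i(t)\<close> be the weight of all unfinished flows at port \<open>i\<close>, unreleased ones
  included, so that \<open>L\<^sub>i\<close> is nonincreasing. While a released flow is unfinished, its rate after
  time \<open>a\<close> is at least \<open>w\<^sub>k / (L\<^sub>i(a)/c\<^sub>i + L\<^sub>j(a)/c\<^sub>j)\<close>, hence
  \<open>d\<^sub>f (L\<^sub>i(a)/c\<^sub>i + L\<^sub>j(a)/c\<^sub>j) \<ge> w\<^sub>k (T\<^sub>f - 1 - a)\<close>. Since total completion time scales with speed,
  the dual price of a port in slot \<open>s\<close> may be taken from a later time: with the price
  \<open>L\<^sub>i(4s + 3) / (4c\<^sub>i)\<close>, weak duality gives
  \<open>(\<Sum>\<^sub>f w\<^sub>k T\<^sub>f) / 4 \<le> (\<Sum>\<^sub>f w\<^sub>k T\<^sub>k) + 2 (\<Sum>\<^sub>f w\<^sub>k T\<^sub>f) / 16\<close> for the completion times \<open>T\<^sub>k\<close> of any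
  feasible schedule, which is the bound with factor \<open>8\<close>.
\<close>

locale coflow_switch =
  fixes I :: "('p::finite, 'k::finite) coflow_instance"
  assumes valid: "valid_instance I"
begin

lemma cap_in_pos: "cap_in I i > 0"
  and cap_out_pos: "cap_out I j > 0"
  and demand_nonneg: "demand I i j k \<ge> 0"
  and weight_pos: "weight I k > 0"
  using valid by (auto simp: valid_instance_def)

section \<open>Pending flows and the loads they put on the ports\<close>

definition pending :: "nat \<Rightarrow> 'p \<Rightarrow> 'p \<Rightarrow> 'k \<Rightarrow> real" where
  "pending t = unfinished I (blindflow_sent I t)"

definition in_load :: "nat \<Rightarrow> 'p \<Rightarrow> real" where
  "in_load t i = (\<Sum>k\<in>UNIV. \<Sum>j\<in>UNIV. weight I k * pending t i j k)"

definition out_load :: "nat \<Rightarrow> 'p \<Rightarrow> real" where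
  "out_load t j = (\<Sum>k\<in>UNIV. \<Sum>i\<in>UNIV. weight I k * pending t i j k)"

text \<open>Divided by the capacity, this is the input term in the denominator of the allocation
  rule. Unlike \<open>in_load\<close>, it can jump up when a coflow is released.\<close>

definition released_in_load :: "nat \<Rightarrow> 'p \<Rightarrow> real" where
  "released_in_load t i = (\<Sum>k\<in>released I t. \<Sum>j\<in>UNIV. weight I k * pending t i j k)"

definition released_out_load :: "nat \<Rightarrow> 'p \<Rightarrow> real" where
  "released_out_load t j = (\<Sum>k\<in>released I t. \<Sum>i\<in>UNIV. weight I k * pending t i j k)"

lemma pending_cases: "pending t i j k = 0 \<or> pending t i j k = 1"
  by (simp add: pending_def unfinished_def)

lemma pending_bounds: "0 \<le> pending t i j k" "pending t i j k \<le> 1"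
  using pending_cases[of t i j k] by auto

lemma weighted_pending_nonneg: "0 \<le> weight I k * pending t i j k"
  using weight_pos[of k] pending_bounds by (simp add: less_imp_le)

lemma released_in_load_le: "released_in_load t i \<le> in_load t i"
  unfolding released_in_load_def in_load_def
  by (rule sum_mono2) (auto intro!: sum_nonneg weighted_pending_nonneg)

lemma released_out_load_le: "released_out_load t j \<le> out_load t j"
  unfolding released_out_load_def out_load_def
  by (rule sum_mono2) (auto intro!: sum_nonneg weighted_pending_nonneg)

text \<open>Used to see that the denominator of the rule is positive as soon as a released flow is
  pending at the port.\<close>

lemma released_in_load_ge:
  assumes "k \<in> released I t"
  shows "weight I k * pending t i j k \<le> released_in_load t i"
proof -
  have "weight I k * pending t i j k \<le> (\<Sum>j\<in>UNIV. weight I k * pending t i j k)"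
    by (rule member_le_sum) (auto intro: weighted_pending_nonneg)
  also have "\<dots> \<le> released_in_load t i"
    unfolding released_in_load_def
    by (rule member_le_sum[OF assms]) (auto intro!: sum_nonneg weighted_pending_nonneg)
  finally show ?thesis .
qed

lemma released_out_load_ge:
  assumes "k \<in> released I t"
  shows "weight I k * pending t i j k \<le> released_out_load t j"
proof -
  have "weight I k * pending t i j k \<le> (\<Sum>i\<in>UNIV. weight I k * pending t i j k)"
    by (rule member_le_sum) (auto intro: weighted_pending_nonneg)
  also have "\<dots> \<le> released_out_load t j"
    unfolding released_out_load_def
    by (rule member_le_sum[OF assms]) (auto intro!: sum_nonneg weighted_pending_nonneg)
  finally show ?thesis .
qed

lemma released_in_load_nonneg: "0 \<le> released_in_load t i"
  unfolding released_in_load_def by (intro sum_nonneg weighted_pending_nonneg)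

lemma released_out_load_nonneg: "0 \<le> released_out_load t j"
  unfolding released_out_load_def by (intro sum_nonneg weighted_pending_nonneg)

lemma in_load_nonneg: "0 \<le> in_load t i"
  unfolding in_load_def by (intro sum_nonneg weighted_pending_nonneg)

lemma out_load_nonneg: "0 \<le> out_load t j"
  unfolding out_load_def by (intro sum_nonneg weighted_pending_nonneg)

section \<open>Rates and capacity constraints\<close>

lemma blindflow_unreleased: "k \<notin> released I t \<Longrightarrow> blindflow I i j k t = 0"
  by (simp add: blindflow_def blindflow_alloc_def released_def)

lemma blindflow_rate:
  assumes "k \<in> released I t"
  shows "blindflow I i j k t = weight I k * pending t i j k /
           (released_out_load t j / cap_out I j + released_in_load t i / cap_in I i)"
  using assms
  by (simp add: blindflow_def blindflow_alloc_def pending_def released_def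
      released_in_load_def released_out_load_def sum_divide_distrib)

lemma blindflow_nonneg: "0 \<le> blindflow I i j k t"
proof (cases "k \<in> released I t")
  case True
  show ?thesis
    unfolding blindflow_rate[OF True]
    by (intro divide_nonneg_nonneg add_nonneg_nonneg weighted_pending_nonneg
        released_out_load_nonneg released_in_load_nonneg
        less_imp_le[OF cap_in_pos] less_imp_le[OF cap_out_pos])
qed (simp add: blindflow_unreleased)

text \<open>Dropping the output term from the denominator can only raise the rate. What remains is
  the flow's proportional share of the input capacity, and such shares sum to at most that
  capacity.\<close>

lemma blindflow_le_in:
  assumes k: "k \<in> released I t"
  shows "blindflow I i j k t
           \<le> weight I k * pending t i j k * (cap_in I i / released_in_load t i)"
proof (cases "pending t i j k = 0")
  case False
  then have p: "pending t i j k = 1" using pending_cases by blast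
  have pos: "0 < released_in_load t i"
    using released_in_load_ge[OF k, of i j] weight_pos[of k] p by simp
  have "blindflow I i j k t \<le> weight I k * pending t i j k / (released_in_load t i / cap_in I i)"
    unfolding blindflow_rate[OF k]
    using pos cap_in_pos[of i] cap_out_pos[of j] released_out_load_nonneg[of t j]
    by (intro divide_left_mono weighted_pending_nonneg mult_pos_pos add_nonneg_pos) auto
  then show ?thesis by simp
qed (simp add: blindflow_rate[OF k])

lemma blindflow_le_out:
  assumes k: "k \<in> released I t"
  shows "blindflow I i j k t
           \<le> weight I k * pending t i j k * (cap_out I j / released_out_load t j)"
proof (cases "pending t i j k = 0")
  case False
  then have p: "pending t i j k = 1" using pending_cases by blast
  have pos: "0 < released_out_load t j"
    using released_out_load_ge[OF k, of i j] weight_pos[of k] p by simp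
  have "blindflow I i j k t \<le> weight I k * pending t i j k / (released_out_load t j / cap_out I j)"
    unfolding blindflow_rate[OF k]
    using pos cap_in_pos[of i] cap_out_pos[of j] released_in_load_nonneg[of t i]
    by (intro divide_left_mono weighted_pending_nonneg mult_pos_pos add_pos_nonneg) auto
  then show ?thesis by simp
qed (simp add: blindflow_rate[OF k])

lemma blindflow_cap_in: "(\<Sum>k\<in>released I t. \<Sum>j\<in>UNIV. blindflow I i j k t) \<le> cap_in I i"
proof -
  have "(\<Sum>k\<in>released I t. \<Sum>j\<in>UNIV. blindflow I i j k t)
      \<le> (\<Sum>k\<in>released I t. \<Sum>j\<in>UNIV.
            weight I k * pending t i j k * (cap_in I i / released_in_load t i))"
    by (intro sum_mono blindflow_le_in)
  also have "\<dots> = released_in_load t i * (cap_in I i / released_in_load t i)"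
    by (simp only: released_in_load_def sum_distrib_right)
  \<comment> \<open>With zero load, division by zero yields 0 and the product is 0; otherwise the
    load cancels and the capacity remains.\<close>
  also have "\<dots> \<le> cap_in I i"
    using cap_in_pos[of i] by simp
  finally show ?thesis .
qed

lemma blindflow_cap_out: "(\<Sum>k\<in>released I t. \<Sum>i\<in>UNIV. blindflow I i j k t) \<le> cap_out I j"
proof -
  have "(\<Sum>k\<in>released I t. \<Sum>i\<in>UNIV. blindflow I i j k t)
      \<le> (\<Sum>k\<in>released I t. \<Sum>i\<in>UNIV.
            weight I k * pending t i j k * (cap_out I j / released_out_load t j))"
    by (intro sum_mono blindflow_le_out)
  also have "\<dots> = released_out_load t j * (cap_out I j / released_out_load t j)"
    by (simp only: released_out_load_def sum_distrib_right)
  also have "\<dots> \<le> cap_out I j"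
    using cap_out_pos[of j] by simp
  finally show ?thesis .
qed

text \<open>Links the two forms of the capacity constraints: sums over released coflows and, in
  \<open>feasible_rates\<close>, sums over all coflows.\<close>

lemma sum_released_swap:
  fixes f :: "'p \<Rightarrow> 'k \<Rightarrow> real"
  assumes "\<And>j k. k \<notin> released I t \<Longrightarrow> f j k = 0"
  shows "(\<Sum>k\<in>released I t. \<Sum>j\<in>UNIV. f j k) = (\<Sum>j\<in>UNIV. \<Sum>k\<in>UNIV. f j k)"
  by (subst sum.swap, rule sum.cong[OF refl], rule sum.mono_neutral_left) (auto simp: assms)

lemma feasible_rates_blindflow: "feasible_rates I (blindflow I)"
  unfolding feasible_rates_def
proof (intro conjI allI impI)
  fix i j t
  show "(\<Sum>j\<in>UNIV. \<Sum>k\<in>UNIV. blindflow I i j k t) \<le> cap_in I i"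
    using blindflow_cap_in[of i t] by (simp add: sum_released_swap blindflow_unreleased)
  show "(\<Sum>i\<in>UNIV. \<Sum>k\<in>UNIV. blindflow I i j k t) \<le> cap_out I j"
    using blindflow_cap_out[of j t] by (simp add: sum_released_swap blindflow_unreleased)
qed (auto simp: blindflow_nonneg blindflow_unreleased released_def)

section \<open>Monotonicity in time and lower bounds on progress\<close>

lemma sent_mono: "s \<le> t \<Longrightarrow> blindflow_sent I s i j k \<le> blindflow_sent I t i j k"
  unfolding blindflow_sent_eq by (rule sum_mono2) (auto intro: blindflow_nonneg)

lemma pending_antimono: "s \<le> t \<Longrightarrow> pending t i j k \<le> pending s i j k"
  using sent_mono[of s t i j k] by (auto simp: pending_def unfinished_def)

lemma in_load_antimono: "s \<le> t \<Longrightarrow> in_load t i \<le> in_load s i"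
  unfolding in_load_def
  by (intro sum_mono mult_left_mono pending_antimono less_imp_le[OF weight_pos])

lemma out_load_antimono: "s \<le> t \<Longrightarrow> out_load t j \<le> out_load s j"
  unfolding out_load_def
  by (intro sum_mono mult_left_mono pending_antimono less_imp_le[OF weight_pos])

text \<open>A nonincreasing upper bound on the denominator of the allocation rule, which itself need
  not be monotone.\<close>

definition congestion :: "nat \<Rightarrow> 'p \<Rightarrow> 'p \<Rightarrow> real" where
  "congestion t i j = in_load t i / cap_in I i + out_load t j / cap_out I j"

lemma congestion_nonneg: "0 \<le> congestion t i j"
  unfolding congestion_def
  by (intro add_nonneg_nonneg divide_nonneg_pos in_load_nonneg out_load_nonneg
      cap_in_pos cap_out_pos)

lemma congestion_antimono: "s \<le> t \<Longrightarrow> congestion t i j \<le> congestion s i j"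
  unfolding congestion_def
  by (intro add_mono divide_right_mono in_load_antimono out_load_antimono
      less_imp_le[OF cap_in_pos] less_imp_le[OF cap_out_pos])

lemma blindflow_ge:
  assumes k: "k \<in> released I t" and p: "pending t i j k = 1" and "a \<le> t"
  shows "0 < congestion a i j" and "weight I k / congestion a i j \<le> blindflow I i j k t"
proof -
  let ?D = "released_out_load t j / cap_out I j + released_in_load t i / cap_in I i"
  have "0 < released_in_load t i"
    using released_in_load_ge[OF k, of i j] weight_pos[of k] p by simp
  then have D: "0 < ?D"
    using cap_in_pos[of i] cap_out_pos[of j] released_out_load_nonneg[of t j]
    by (intro add_nonneg_pos) auto
  have "?D \<le> congestion t i j"
    unfolding congestion_def
    using released_in_load_le[of t i] released_out_load_le[of t j]
      cap_in_pos[of i] cap_out_pos[of j]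
    by (subst add.commute, intro add_mono divide_right_mono) auto
  also have "\<dots> \<le> congestion a i j" by (rule congestion_antimono[OF \<open>a \<le> t\<close>])
  finally have le: "?D \<le> congestion a i j" .
  with D show pos: "0 < congestion a i j" by linarith
  show "weight I k / congestion a i j \<le> blindflow I i j k t"
    unfolding blindflow_rate[OF k] p
    using le D pos weight_pos[of k] by (auto intro!: divide_left_mono simp: less_imp_le)
qed

text \<open>A flow pending at \<open>t\<close> was pending in all slots from \<open>a\<close> on,
  each giving it at least \<open>weight I k / congestion a i j\<close>, yet it has received less
  than its demand.\<close>

lemma sent_lower_bound:
  assumes a: "real a \<ge> release I k" and p: "pending t i j k = 1" and "a \<le> t"
  shows "weight I k * (real t - real a) \<le> demand I i j k * congestion a i j"
proof -
  have ps: "pending s i j k = 1" if "s \<le> t" for s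
    using pending_antimono[OF that, of i j k] pending_bounds(2)[of s i j k] p by linarith
  have rel: "k \<in> released I s" if "a \<le> s" for s
    using a that by (simp add: released_def)
  have pos: "0 < congestion a i j"
    by (rule blindflow_ge(1)[OF rel[OF order_refl] ps[OF \<open>a \<le> t\<close>] order_refl])
  have "(real t - real a) * (weight I k / congestion a i j)
      = (\<Sum>s\<in>{a..<t}. weight I k / congestion a i j)"
    using \<open>a \<le> t\<close> by (simp add: of_nat_diff)
  also have "\<dots> \<le> (\<Sum>s\<in>{a..<t}. blindflow I i j k s)"
    by (intro sum_mono blindflow_ge(2) rel ps) auto
  also have "\<dots> \<le> blindflow_sent I t i j k"
    unfolding blindflow_sent_eq by (rule sum_mono2) (auto intro: blindflow_nonneg)
  also have "\<dots> \<le> demand I i j k"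
    using p by (auto simp: pending_def unfinished_def split: if_splits)
  finally show ?thesis using pos by (simp add: field_simps)
qed

lemma eventually_not_pending: "\<exists>t. pending t i j k = 0"
proof (rule ccontr)
  assume "\<nexists>t. pending t i j k = 0"
  then have p: "pending t i j k = 1" for t using pending_cases by blast
  define a where "a = nat \<lceil>release I k\<rceil>"
  have a: "release I k \<le> real a" unfolding a_def by linarith
  \<comment> \<open>A flow still pending \<open>n\<close> slots after \<open>a\<close> would violate
    \<open>sent_lower_bound\<close>.\<close>
  obtain n where n: "demand I i j k * congestion a i j / weight I k < real n"
    using reals_Archimedean2 by blast
  have "weight I k * (real (a + n) - real a) \<le> demand I i j k * congestion a i j"
    by (rule sent_lower_bound[OF a p]) simp
  with n weight_pos[of k] show False by (simp add: field_simps)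
qed

section \<open>Finishing times of single flows\<close>

definition finish :: "'p \<Rightarrow> 'p \<Rightarrow> 'k \<Rightarrow> nat" where
  "finish i j k = (LEAST t. pending t i j k = 0)"

text \<open>The indicator is 0 or 1, nonincreasing in time and eventually 0.\<close>

lemma pending_eq: "pending t i j k = (if t < finish i j k then 1 else 0)"
proof -
  obtain t0 where "pending t0 i j k = 0" using eventually_not_pending by blast
  then have z: "pending (finish i j k) i j k = 0"
    unfolding finish_def by (rule LeastI)
  show ?thesis
  proof (cases "t < finish i j k")
    case True
    then have "pending t i j k \<noteq> 0" unfolding finish_def by (rule not_less_Least)
    with True pending_cases show ?thesis by auto
  next
    case False
    then have "pending t i j k \<le> 0" using pending_antimono[of "finish i j k" t i j k] z by simp
    with False pending_bounds(1)[of t i j k] show ?thesis by simp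
  qed
qed

lemma finish_no_demand: "demand I i j k = 0 \<Longrightarrow> finish i j k = 0"
  using pending_eq[of 0 i j k] by (auto simp: pending_def unfinished_def split: if_splits)

text \<open>The sum is a crude substitute for the maximum of the finishing times. It proves
  termination and also bounds the completion time in \<open>blindflow_cost_le\<close>.\<close>

lemma blindflow_done_by: "done_by I (blindflow I) k (\<Sum>i\<in>UNIV. \<Sum>j\<in>UNIV. finish i j k)"
  unfolding done_by_def
proof (intro allI impI conjI)
  fix i j assume d: "demand I i j k > 0"
  let ?T = "\<Sum>i\<in>UNIV. \<Sum>j\<in>UNIV. finish i j k"
  have "finish i j k \<le> (\<Sum>j\<in>UNIV. finish i j k)"
    by (rule member_le_sum) auto
  also have "\<dots> \<le> ?T" by (rule member_le_sum) auto
  finally have le: "finish i j k \<le> ?T" .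
  then have "pending ?T i j k = 0" by (simp add: pending_eq)
  then have "demand I i j k \<le> blindflow_sent I ?T i j k"
    using d by (auto simp: pending_def unfinished_def split: if_splits)
  then show "1 \<le> (\<Sum>t<?T. blindflow I i j k t / demand I i j k)"
    using d by (simp add: blindflow_sent_eq flip: sum_divide_distrib)
  fix t assume "?T \<le> t"
  with le have "pending t i j k = 0" by (simp add: pending_eq)
  then show "blindflow I i j k t = 0"
    by (cases "k \<in> released I t") (simp_all add: blindflow_rate blindflow_unreleased)
qed

lemma feasible_schedule_blindflow:
  "feasible_schedule I (blindflow I) (completion_time I (blindflow I))"
  unfolding feasible_schedule_def completion_time_def
  by (intro conjI allI feasible_rates_blindflow)
    (rule LeastI[where P = "done_by I (blindflow I) _", OF blindflow_done_by])

section \<open>Total flow cost and its expression by loads\<close>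

definition flow_cost :: real where
  "flow_cost = (\<Sum>i\<in>UNIV. \<Sum>j\<in>UNIV. \<Sum>k\<in>UNIV. weight I k * real (finish i j k))"

lemma sum3_rotate:
  "(\<Sum>i\<in>A. \<Sum>j\<in>B. \<Sum>k\<in>C. f i j k) = (\<Sum>k\<in>C. \<Sum>i\<in>A. \<Sum>j\<in>B. f i j k)"
  for f :: "'a \<Rightarrow> 'b \<Rightarrow> 'c \<Rightarrow> real"
  by (subst sum.swap[of _ C]) (intro sum.cong refl sum.swap)

lemma blindflow_cost_le: "cost I (completion_time I (blindflow I)) \<le> flow_cost"
proof -
  have "cost I (completion_time I (blindflow I))
      \<le> (\<Sum>k\<in>UNIV. weight I k * real (\<Sum>i\<in>UNIV. \<Sum>j\<in>UNIV. finish i j k))"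
    unfolding cost_def completion_time_def
    by (intro sum_mono mult_left_mono less_imp_le[OF weight_pos] of_nat_mono Least_le
        blindflow_done_by)
  also have "\<dots> = flow_cost"
    unfolding flow_cost_def by (subst sum3_rotate) (simp add: sum_distrib_left)
  finally show ?thesis .
qed

lemma finish_demand_bound:
  assumes a: "real a \<ge> release I k"
  shows "weight I k * (real (finish i j k) - 1 - real a) \<le> demand I i j k * congestion a i j"
proof (cases "a < finish i j k")
  case True
  \<comment> \<open>The last time at which the flow is pending is one before \<open>finish\<close>,
    whence the \<open>- 1\<close> in the bound.\<close>
  then have "pending (finish i j k - 1) i j k = 1" by (simp add: pending_eq)
  from sent_lower_bound[OF a this] True show ?thesis by (simp add: of_nat_diff)
next
  case False
  then have "weight I k * (real (finish i j k) - 1 - real a) \<le> 0"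
    using weight_pos[of k] by (simp add: mult_le_0_iff)
  also have "0 \<le> demand I i j k * congestion a i j"
    by (intro mult_nonneg_nonneg demand_nonneg congestion_nonneg)
  finally show ?thesis .
qed

lemma sum_in_load_le: "(\<Sum>t<n. \<Sum>i\<in>UNIV. in_load t i) \<le> flow_cost"
proof -
  have "(\<Sum>t<n. \<Sum>i\<in>UNIV. in_load t i)
      = (\<Sum>i\<in>UNIV. \<Sum>j\<in>UNIV. \<Sum>k\<in>UNIV. \<Sum>t<n. weight I k * pending t i j k)"
    unfolding in_load_def
    by (subst sum.swap, rule sum.cong[OF refl], subst sum3_rotate, subst sum.swap)
      (simp add: sum.swap[of _ "{..<n}"])
  also have "\<dots> \<le> flow_cost"
    unfolding flow_cost_def
  proof (intro sum_mono)
    fix i j :: 'p and k :: 'k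
    \<comment> \<open>Each flow counts at a single input port, once per slot before its finish;
      cutting at \<open>n\<close> only loses terms.\<close>
    have "(\<Sum>t<n. pending t i j k) = real (card ({..<n} \<inter> {..<finish i j k}))"
      by (simp add: pending_eq sum.If_cases lessThan_def)
    also have "\<dots> \<le> real (finish i j k)"
      by (metis card_lessThan card_mono finite_lessThan inf_le2 of_nat_le_iff)
    finally show "(\<Sum>t<n. weight I k * pending t i j k) \<le> weight I k * real (finish i j k)"
      using weight_pos[of k] by (simp flip: sum_distrib_left)
  qed
  finally show ?thesis .
qed

text \<open>Every flow has one input and one output port, so both sides are the total pending
  weight.\<close>

lemma sum_out_load_eq: "(\<Sum>j\<in>UNIV. out_load t j) = (\<Sum>i\<in>UNIV. in_load t i)"
  unfolding out_load_def in_load_def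
  by (subst (1 2) sum.swap) (intro sum.cong refl sum.swap)

text \<open>In each block of four consecutive slots the last value is the smallest.\<close>

lemma sum_sampled_le:
  fixes f :: "nat \<Rightarrow> real"
  assumes "\<And>s t. s \<le> t \<Longrightarrow> f t \<le> f s"
  shows "4 * (\<Sum>s<n. f (4 * s + 3)) \<le> (\<Sum>t<4 * n. f t)"
proof (induction n)
  case (Suc n)
  have "(\<Sum>t<4 * Suc n. f t)
      = (\<Sum>t<4 * n. f t) + f (4 * n) + f (4 * n + 1) + f (4 * n + 2) + f (4 * n + 3)"
    by (simp add: eval_nat_numeral)
  moreover have "f (4 * n + 3) \<le> f (4 * n)" "f (4 * n + 3) \<le> f (4 * n + 1)"
    "f (4 * n + 3) \<le> f (4 * n + 2)"
    by (auto intro: assms)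
  ultimately show ?case using Suc by simp
qed simp

lemma sampled_load_le: "(\<Sum>s<n. \<Sum>i\<in>UNIV. in_load (4 * s + 3) i) \<le> flow_cost / 4"
proof -
  have "4 * (\<Sum>s<n. \<Sum>i\<in>UNIV. in_load (4 * s + 3) i) \<le> (\<Sum>t<4 * n. \<Sum>i\<in>UNIV. in_load t i)"
    by (rule sum_sampled_le) (intro sum_mono in_load_antimono)
  with sum_in_load_le[of "4 * n"] show ?thesis by linarith
qed

section \<open>Weak duality against an arbitrary feasible schedule\<close>

lemma dual_constraint:
  assumes "feasible_schedule I x T" "demand I i j k > 0"
  shows "weight I k * real (finish i j k) / 4 - weight I k * real (T k)
       \<le> (\<Sum>s<T k. x i j k s * (congestion (4 * s + 3) i j / 4))"
    (is "?B \<le> ?R")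
proof -
  let ?d = "demand I i j k"
  have x0: "0 \<le> x i j k s" and xrel: "real s < release I k \<Longrightarrow> x i j k s = 0" for s
    using assms(1) by (auto simp: feasible_schedule_def feasible_rates_def)
  have sum1: "1 \<le> (\<Sum>s<T k. x i j k s / ?d)"
    using assms by (auto simp: feasible_schedule_def done_by_def)
  \<comment> \<open>Settles the case of negative \<open>?B\<close>, where fractions summing to more
    than 1 do not help.\<close>
  have R0: "0 \<le> ?R"
    by (intro sum_nonneg mult_nonneg_nonneg divide_nonneg_nonneg x0 congestion_nonneg) auto
  have slot: "x i j k s / ?d * ?B \<le> x i j k s * (congestion (4 * s + 3) i j / 4)"
    if s: "s < T k" for s
  proof (cases "real s < release I k")
    case False
    then have "real (4 * s + 3) \<ge> release I k" by simp
    \<comment> \<open>The offset 3 is chosen so that \<open>1 + (4 * s + 3) = 4 * (s + 1)\<close>;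
      after division by 4 this is the end \<open>s + 1\<close> of slot \<open>s\<close>, which is at
      most \<open>T k\<close>.\<close>
    from finish_demand_bound[OF this, of i j]
    have "weight I k * real (finish i j k) / 4 - weight I k * real (s + 1)
        \<le> ?d * (congestion (4 * s + 3) i j / 4)"
      by (simp add: algebra_simps)
    moreover have "weight I k * real (s + 1) \<le> weight I k * real (T k)"
      using s weight_pos[of k] by (intro mult_left_mono) auto
    ultimately have "?B \<le> ?d * (congestion (4 * s + 3) i j / 4)" by linarith
    then have "x i j k s / ?d * ?B \<le> x i j k s / ?d * (?d * (congestion (4 * s + 3) i j / 4))"
      using x0 assms(2) by (intro mult_left_mono) auto
    then show ?thesis using assms(2) by simp
  qed (simp add: xrel)
  \<comment> \<open>The per-slot bounds are weighted by the fractions of the demand that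
    \<open>x\<close> sends; these sum to at least 1.\<close>
  have "(\<Sum>s<T k. x i j k s / ?d) * ?B \<le> ?R"
    unfolding sum_distrib_right by (intro sum_mono slot) simp
  moreover have "?B \<le> (\<Sum>s<T k. x i j k s / ?d) * ?B" if "0 \<le> ?B"
    using mult_right_mono[OF sum1 that] by simp
  ultimately show ?thesis using R0 by linarith
qed

lemma flow_cost_le:
  assumes feas: "feasible_schedule I x T"
  shows "flow_cost \<le> 8 * real (max_flows I) * cost I T"
proof -
  \<comment> \<open>A common horizon for all coflows, so that the sum over slots can be exchanged
    with the sum over \<open>k\<close>.\<close>
  define N where "N = (\<Sum>k\<in>UNIV. T k)"
  have TN: "T k \<le> N" for k unfolding N_def by (rule member_le_sum) auto
  let ?b = "\<lambda>s i. in_load (4 * s + 3) i / cap_in I i / 4"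
  let ?c = "\<lambda>s j. out_load (4 * s + 3) j / cap_out I j / 4"
  let ?dp = "\<lambda>i j k. if demand I i j k > 0 then 1 else 0 :: real"
  have x0: "0 \<le> x i j k s" for i j k s
    using feas by (auto simp: feasible_schedule_def feasible_rates_def)
  have b0: "0 \<le> ?b s i" and c0: "0 \<le> ?c s j" for s i j
    using in_load_nonneg cap_in_pos out_load_nonneg cap_out_pos by (auto simp: less_imp_le)
  have cin: "(\<Sum>j\<in>UNIV. \<Sum>k\<in>UNIV. x i j k s) \<le> cap_in I i"
    and cout: "(\<Sum>i\<in>UNIV. \<Sum>k\<in>UNIV. x i j k s) \<le> cap_out I j" for i j s
    using feas by (auto simp: feasible_schedule_def feasible_rates_def)
  have flow: "weight I k * real (finish i j k) / 4
      \<le> ?dp i j k * (weight I k * real (T k)) + (\<Sum>s<N. x i j k s * (?b s i + ?c s j))"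
    for i j k
  proof (cases "demand I i j k > 0")
    case True
    have "(\<Sum>s<T k. x i j k s * (congestion (4 * s + 3) i j / 4))
        \<le> (\<Sum>s<N. x i j k s * (congestion (4 * s + 3) i j / 4))"
      using TN[of k] x0 congestion_nonneg by (intro sum_mono2) auto
    with dual_constraint[OF feas True] True show ?thesis
      by (simp add: congestion_def add_divide_distrib)
  next
    case False
    then have "demand I i j k = 0" using demand_nonneg[of i j k] by simp
    then show ?thesis
      using x0 b0 c0 by (simp add: finish_no_demand sum_nonneg)
  qed
  have prices_in: "(\<Sum>i\<in>UNIV. \<Sum>j\<in>UNIV. \<Sum>k\<in>UNIV. \<Sum>s<N. x i j k s * ?b s i) \<le> flow_cost / 16"
  proof -
    have "(\<Sum>i\<in>UNIV. \<Sum>j\<in>UNIV. \<Sum>k\<in>UNIV. \<Sum>s<N. x i j k s * ?b s i)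
        = (\<Sum>s<N. \<Sum>i\<in>UNIV. (\<Sum>j\<in>UNIV. \<Sum>k\<in>UNIV. x i j k s) * ?b s i)"
      unfolding sum_distrib_right by (simp only: sum.swap[of _ "{..<N}"])
    \<comment> \<open>Only here does the input capacity constraint of \<open>x\<close> enter; the
      capacity then cancels against the one in the price.\<close>
    also have "\<dots> \<le> (\<Sum>s<N. \<Sum>i\<in>UNIV. cap_in I i * ?b s i)"
      by (intro sum_mono mult_right_mono cin b0)
    also have "\<dots> = (\<Sum>s<N. \<Sum>i\<in>UNIV. in_load (4 * s + 3) i) / 4"
      using cap_in_pos by (simp add: sum_divide_distrib less_imp_neq[symmetric])
    \<comment> \<open>One factor 1/4 comes from the price, the other from sampling every fourth
      slot.\<close>
    also have "\<dots> \<le> flow_cost / 16" using sampled_load_le[of N] by simp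
    finally show ?thesis .
  qed
  have prices_out: "(\<Sum>i\<in>UNIV. \<Sum>j\<in>UNIV. \<Sum>k\<in>UNIV. \<Sum>s<N. x i j k s * ?c s j) \<le> flow_cost / 16"
  proof -
    have "(\<Sum>i\<in>UNIV. \<Sum>j\<in>UNIV. \<Sum>k\<in>UNIV. \<Sum>s<N. x i j k s * ?c s j)
        = (\<Sum>j\<in>UNIV. \<Sum>i\<in>UNIV. \<Sum>k\<in>UNIV. \<Sum>s<N. x i j k s * ?c s j)"
      by (rule sum.swap)
    also have "\<dots> = (\<Sum>s<N. \<Sum>j\<in>UNIV. (\<Sum>i\<in>UNIV. \<Sum>k\<in>UNIV. x i j k s) * ?c s j)"
      unfolding sum_distrib_right by (simp only: sum.swap[of _ "{..<N}"])
    also have "\<dots> \<le> (\<Sum>s<N. \<Sum>j\<in>UNIV. cap_out I j * ?c s j)"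
      by (intro sum_mono mult_right_mono cout c0)
    also have "\<dots> = (\<Sum>s<N. \<Sum>j\<in>UNIV. out_load (4 * s + 3) j) / 4"
      using cap_out_pos by (simp add: sum_divide_distrib less_imp_neq[symmetric])
    also have "\<dots> \<le> flow_cost / 16" using sampled_load_le[of N] by (simp add: sum_out_load_eq)
    finally show ?thesis .
  qed
  have count: "(\<Sum>i\<in>UNIV. \<Sum>j\<in>UNIV. ?dp i j k) \<le> real (max_flows I)" for k
  proof -
    have "(\<Sum>i\<in>UNIV. \<Sum>j\<in>UNIV. ?dp i j k) = (\<Sum>(i, j)\<in>UNIV. ?dp i j k)"
      by (simp add: sum.cartesian_product)
    also have "\<dots> = real (card {(i, j). demand I i j k > 0})"
      by (simp add: case_prod_unfold sum.If_cases)
    also have "{(i, j). demand I i j k > 0} = {(i, j). demand I i j k \<noteq> 0}"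
      using demand_nonneg by (auto simp: less_le)
    also have "card \<dots> \<le> max_flows I"
      unfolding max_flows_def by (rule Max_ge) auto
    finally show ?thesis by simp
  qed
  have "(\<Sum>i\<in>UNIV. \<Sum>j\<in>UNIV. \<Sum>k\<in>UNIV. ?dp i j k * (weight I k * real (T k)))
      = (\<Sum>k\<in>UNIV. (\<Sum>i\<in>UNIV. \<Sum>j\<in>UNIV. ?dp i j k) * (weight I k * real (T k)))"
    by (subst sum3_rotate) (simp only: sum_distrib_right)
  also have "\<dots> \<le> (\<Sum>k\<in>UNIV. real (max_flows I) * (weight I k * real (T k)))"
    by (intro sum_mono mult_right_mono count mult_nonneg_nonneg less_imp_le[OF weight_pos]) auto
  also have "\<dots> = real (max_flows I) * cost I T"
    by (simp add: cost_def sum_distrib_left)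
  finally have primal: "(\<Sum>i\<in>UNIV. \<Sum>j\<in>UNIV. \<Sum>k\<in>UNIV. ?dp i j k * (weight I k * real (T k)))
      \<le> real (max_flows I) * cost I T" .
  have "flow_cost / 4 = (\<Sum>i\<in>UNIV. \<Sum>j\<in>UNIV. \<Sum>k\<in>UNIV. weight I k * real (finish i j k) / 4)"
    by (simp only: flow_cost_def sum_divide_distrib)
  also have "\<dots> \<le> (\<Sum>i\<in>UNIV. \<Sum>j\<in>UNIV. \<Sum>k\<in>UNIV.
      ?dp i j k * (weight I k * real (T k)) + (\<Sum>s<N. x i j k s * (?b s i + ?c s j)))"
    by (intro sum_mono flow)
  also have "\<dots> = (\<Sum>i\<in>UNIV. \<Sum>j\<in>UNIV. \<Sum>k\<in>UNIV. ?dp i j k * (weight I k * real (T k)))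
      + ((\<Sum>i\<in>UNIV. \<Sum>j\<in>UNIV. \<Sum>k\<in>UNIV. \<Sum>s<N. x i j k s * ?b s i)
        + (\<Sum>i\<in>UNIV. \<Sum>j\<in>UNIV. \<Sum>k\<in>UNIV. \<Sum>s<N. x i j k s * ?c s j))"
    by (simp only: distrib_left sum.distrib)
  \<comment> \<open>The two price sums take 1/16 each from the 1/4 on the left, leaving
    \<open>flow_cost / 8\<close>.\<close>
  finally show ?thesis using primal prices_in prices_out by linarith
qed

lemma flow_cost_le_J_opt: "flow_cost \<le> 8 * real (max_flows I) * J_opt I"
proof (cases "max_flows I = 0")
  case True
  \<comment> \<open>Without flows one cannot divide by \<open>max_flows I\<close>, but any feasible
    schedule, such as BlindFlow, gives \<open>flow_cost\<close> at most 0.\<close>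
  with flow_cost_le[OF feasible_schedule_blindflow] show ?thesis by simp
next
  case False
  have "flow_cost / (8 * real (max_flows I)) \<le> J_opt I"
    unfolding J_opt_def
  proof (rule cInf_greatest)
    \<comment> \<open>BlindFlow itself shows that the infimum is over a nonempty set.\<close>
    show "{cost I T | x T. feasible_schedule I x T} \<noteq> {}"
      using feasible_schedule_blindflow by blast
    fix c assume "c \<in> {cost I T | x T. feasible_schedule I x T}"
    then show "flow_cost / (8 * real (max_flows I)) \<le> c"
      using flow_cost_le False by (auto simp: field_simps)
  qed
  with False show ?thesis by (simp add: field_simps)
qed

end

theorem theorem1:
  fixes I :: "('p::finite, 'k::finite) coflow_instance"
  assumes "valid_instance I"
  shows "(\<forall>t i. (\<Sum>k\<in>released I t. \<Sum>j\<in>UNIV. blindflow I i j k t) \<le> cap_in I i) \<and>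
         (\<forall>t j. (\<Sum>k\<in>released I t. \<Sum>i\<in>UNIV. blindflow I i j k t) \<le> cap_out I j) \<and>
         feasible_schedule I (blindflow I) (completion_time I (blindflow I)) \<and>
         cost I (completion_time I (blindflow I)) \<le> 8 * real (max_flows I) * J_opt I"
proof -
  interpret coflow_switch I by standard (rule assms)
  show ?thesis
    using blindflow_cap_in blindflow_cap_out feasible_schedule_blindflow
      order_trans[OF blindflow_cost_le flow_cost_le_J_opt] by blast
qed

end
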